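(* Let $(\tau_1,\tau_2,\tau_3)=(1,0,0)$ and let $\widehat U$ denote the solution of the system (FS) described in the context. Assume that $\chi:=k_3-k_2=0$, that is, $k_2=k_3$. Then $|\widehat U(\xi,t)|$ does not converge to zero when time $t$ goes to infinity.
   Context: Constants: $k_1,k_2,k_3,k_4,k_5>0$, $\gamma\in\mathbb{R}\setminus\{0\}$, $(\tau_1,\tau_2,\tau_3)\in\{(1,0,0),(0,1,0),(0,0,1)\}$, $\epsilon_0\in\{0,1\}$ (both values of $\epsilon_0$ are covered). System (FS): for each $\xi\in\mathbb{R}$, the unknown is $\widehat U(\xi,\cdot)=(\widehat v,\widehat u,\widehat z,\widehat y,\widehat\phi,\widehat\theta,\widehat\sigma,\widehat\eta)^T:[0,\infty)\to\mathbb{C}^8$, with initial datum $\widehat U(\xi,0)=\widehat U_0(\xi)$ and satisfying for $t>0$ $$\begin{cases} \widehat v_t-i\xi\widehat u-\widehat y-\widehat\theta=0,\\ \widehat u_t-ik_1\xi\widehat v+i\tau_1\gamma\xi\widehat\eta=0,\\ \widehat z_t-i\xi\widehat y=0,\\ \widehat y_t-ik_2\xi\widehat z+k_1\widehat v+i\tau_2\gamma\xi\widehat\eta=0,\\ \widehat\phi_t-i\xi\widehat\theta=0,\\ \widehat\theta_t-ik_3\xi\widehat\phi+k_1\widehat v+i\tau_3\gamma\xi\widehat\eta=0,\\ \widehat\sigma_t-i\xi\widehat\eta=0,\\ \widehat\eta_t-ik_4\xi\widehat\sigma+k_5\xi^{2\epsilon_0}\widehat\eta+i\gamma\xi(\tau_1\widehat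 u+\tau_2\widehat y+\tau_3\widehat\theta)=0, \end{cases}$$ where $\xi^{2\epsilon_0}=1$ if $\epsilon_0=0$. $|\cdot|$ is the Euclidean norm on $\mathbb{C}^8$.
   Formalization: The claim fails for the zero initial datum (then the solution is zero), so it is stated as: for every frequency ξ there is an initial datum for which a solution exists and no solution with that datum converges to zero as t goes to infinity. *)

theory Defs
  imports "HOL-Analysis.Analysis"
begin

text \<open>
  The vector \<open>V\<close> collects the unknowns \<open>(v, u, z, y, \<phi>, \<theta>, \<sigma>, \<eta>)\<close> at a fixed time
  and \<open>D\<close> their time derivatives, both indexed by \<open>1, \<dots>, 8\<close> (in the index type \<open>8\<close>
  the numeral \<open>8\<close> denotes the same element as \<open>0\<close>).  For \<open>\<epsilon>0 = 0\<close> the factor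
  \<open>\<xi> ^ (2 * \<epsilon>0)\<close> is \<open>1\<close>, also at \<open>\<xi> = 0\<close>.
\<close>

definition FS_equations ::
  "real \<Rightarrow> real \<Rightarrow> real \<Rightarrow> real \<Rightarrow> real \<Rightarrow> real \<Rightarrow> real \<times> real \<times> real \<Rightarrow> nat \<Rightarrow> real
    \<Rightarrow> complex ^ 8 \<Rightarrow> complex ^ 8 \<Rightarrow> bool"
  where
  "FS_equations k1 k2 k3 k4 k5 \<gamma> \<tau> \<epsilon>0 \<xi> V D \<longleftrightarrow>
    (case \<tau> of (\<tau>1, \<tau>2, \<tau>3) \<Rightarrow>
     let v = V $ 1; u = V $ 2; z = V $ 3; y = V $ 4; \<phi> = V $ 5; \<theta> = V $ 6; \<sigma> = V $ 7; \<eta> = V $ 8 in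
       D $ 1 - \<i> * of_real \<xi> * u - y - \<theta> = 0 \<and>
       D $ 2 - \<i> * of_real k1 * of_real \<xi> * v
         + \<i> * of_real \<tau>1 * of_real \<gamma> * of_real \<xi> * \<eta> = 0 \<and>
       D $ 3 - \<i> * of_real \<xi> * y = 0 \<and>
       D $ 4 - \<i> * of_real k2 * of_real \<xi> * z + of_real k1 * v
         + \<i> * of_real \<tau>2 * of_real \<gamma> * of_real \<xi> * \<eta> = 0 \<and>
       D $ 5 - \<i> * of_real \<xi> * \<theta> = 0 \<and>
       D $ 6 - \<i> * of_real k3 * of_real \<xi> * \<phi> + of_real k1 * v
         + \<i> * of_real \<tau>3 * of_real \<gamma> * of_real \<xi> * \<eta> = 0 \<and>
       D $ 7 - \<i> * of_real \<xi> * \<eta> = 0 \<and>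
       D $ 8 - \<i> * of_real k4 * of_real \<xi> * \<sigma> + of_real k5 * of_real \<xi> ^ (2 * \<epsilon>0) * \<eta>
         + \<i> * of_real \<gamma> * of_real \<xi> * (of_real \<tau>1 * u + of_real \<tau>2 * y + of_real \<tau>3 * \<theta>) = 0)"

text \<open>
  A solution at frequency \<open>\<xi>\<close> is continuous on \<open>[0, \<infinity>)\<close>, takes the value \<open>U0\<close> at time \<open>0\<close>,
  and is differentiable and satisfies the system for \<open>t > 0\<close>; values at negative times are
  irrelevant.
\<close>

definition FS_solution ::
  "real \<Rightarrow> real \<Rightarrow> real \<Rightarrow> real \<Rightarrow> real \<Rightarrow> real \<Rightarrow> real \<times> real \<times> real \<Rightarrow> nat \<Rightarrow> real
    \<Rightarrow> complex ^ 8 \<Rightarrow> (real \<Rightarrow> complex ^ 8) \<Rightarrow> bool"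
  where
  "FS_solution k1 k2 k3 k4 k5 \<gamma> \<tau> \<epsilon>0 \<xi> U0 U \<longleftrightarrow>
     continuous_on {0..} U \<and> U 0 = U0 \<and>
     (\<forall>t>0. \<exists>D. (U has_vector_derivative D) (at t) \<and>
        FS_equations k1 k2 k3 k4 k5 \<gamma> \<tau> \<epsilon>0 \<xi> (U t) D)"

end

theory Submission
  imports Defs
begin

text \<open>
  When \<open>k2 = k3\<close> and \<open>\<tau> = (1, 0, 0)\<close>, the differences \<open>z - \<phi>\<close> and \<open>y - \<theta>\<close> decouple from the
  damped part of the system and solve an undamped wave equation. Hence
  \<open>\<surd>k2 (z - \<phi>) + (y - \<theta>)\<close> only rotates in phase along every solution, with frequency
  \<open>\<xi> \<surd>k2\<close>, so a solution on which it is initially nonzero cannot decay.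
\<close>

text \<open>The integrating factor \<open>cis (- \<omega> * t)\<close> has modulus one and turns
  \<open>w\<close> into a function with zero derivative, hence a constant.\<close>

lemma constant_modulus_of_rotation:
  fixes w :: "real \<Rightarrow> complex" and \<omega> :: real
  assumes cont: "continuous_on {0..} w"
    and deriv: "\<And>t. t > 0 \<Longrightarrow> (w has_vector_derivative (\<i> * of_real \<omega> * w t)) (at t)"
    and "t \<ge> 0"
  shows "norm (w t) = norm (w 0)"
proof -
  define g where "g = (\<lambda>t. cis (- \<omega> * t) * w t)"
  have "g t = g 0"
  \<comment> \<open>The exceptional set \<open>{0}\<close> is there because the equation holds only
    for positive times; continuity bridges the endpoint.\<close>
  proof (rule has_derivative_zero_unique_strong_convex[of "{0..}" "{0}" g])
    show "continuous_on {0..} g"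
      unfolding g_def by (intro continuous_intros cont)
  next
    fix s :: real
    assume "s \<in> {0..} - {0}"
    then have "s > 0" by auto
    have rotate: "((\<lambda>t. cis (- \<omega> * t)) has_vector_derivative (- \<omega>) *\<^sub>R (\<i> * cis (- \<omega> * s))) (at s)"
      by (auto intro!: derivative_eq_intros simp: has_vector_derivative_def)
    have "(g has_vector_derivative 0) (at s)"
      unfolding g_def
      using has_vector_derivative_mult[OF rotate deriv[OF \<open>s > 0\<close>]]
      by (simp add: scaleR_conv_of_real algebra_simps)
    then show "(g has_derivative (\<lambda>h. 0)) (at s within {0..})"
      by (auto simp: has_vector_derivative_def intro: has_derivative_at_withinI)
  qed (use \<open>t \<ge> 0\<close> in auto)
  then have "norm (g t) = norm (g 0)" by simp
  then show ?thesis by (simp add: g_def norm_mult)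
qed

text \<open>For \<open>m * m = k2 = k3\<close>, an eigenvector of the coefficient matrix with
  eigenvalue \<open>\<i> * \<xi> * m\<close>. It is antisymmetric under exchanging
  \<open>(z, y)\<close> with \<open>(\<phi>, \<theta>)\<close>.\<close>

definition undamped_mode :: "real \<Rightarrow> complex ^ 8" where
  "undamped_mode m = axis 3 1 + axis 4 (of_real m) - axis 5 1 - axis 6 (of_real m)"

lemma undamped_mode_nth [simp]:
  "undamped_mode m $ 1 = 0" "undamped_mode m $ 2 = 0"
  "undamped_mode m $ 3 = 1" "undamped_mode m $ 4 = of_real m"
  "undamped_mode m $ 5 = - 1" "undamped_mode m $ 6 = - of_real m"
  "undamped_mode m $ 7 = 0" "undamped_mode m $ 8 = 0"
  by (simp_all add: undamped_mode_def axis_def)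

text \<open>Since \<open>y + \<theta> = 0\<close>, the component \<open>v\<close> is never excited,
  so neither are \<open>u\<close>, \<open>\<sigma>\<close> and the damped \<open>\<eta>\<close>. The
  formula is \<open>cis (\<xi> * m * t)\<close> times the mode, split into real scalings for
  differentiation.\<close>

lemma FS_solution_undamped_mode:
  assumes "k2 \<ge> 0"
  defines "m \<equiv> sqrt k2"
  shows "FS_solution k1 k2 k2 k4 k5 \<gamma> (1, 0, 0) \<epsilon>0 \<xi> (undamped_mode m)
    (\<lambda>t. cos (\<xi> * m * t) *\<^sub>R undamped_mode m + sin (\<xi> * m * t) *\<^sub>R (\<i> *s undamped_mode m))"
    (is "FS_solution _ _ _ _ _ _ _ _ _ _ ?U")
proof -
  have k2: "complex_of_real k2 = of_real m * of_real m"
    using assms by (simp flip: of_real_mult)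
  have "\<exists>D. (?U has_vector_derivative D) (at t) \<and>
      FS_equations k1 k2 k2 k4 k5 \<gamma> (1, 0, 0) \<epsilon>0 \<xi> (?U t) D" for t
  proof (intro exI conjI)
    show "(?U has_vector_derivative (- sin (\<xi> * m * t) * (\<xi> * m)) *\<^sub>R undamped_mode m
        + (cos (\<xi> * m * t) * (\<xi> * m)) *\<^sub>R (\<i> *s undamped_mode m)) (at t)"
      by (auto intro!: derivative_eq_intros)
    show "FS_equations k1 k2 k2 k4 k5 \<gamma> (1, 0, 0) \<epsilon>0 \<xi> (?U t)
        ((- sin (\<xi> * m * t) * (\<xi> * m)) *\<^sub>R undamped_mode m
        + (cos (\<xi> * m * t) * (\<xi> * m)) *\<^sub>R (\<i> *s undamped_mode m))"
      unfolding FS_equations_def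
      by (simp add: Let_def k2 scaleR_conv_of_real[where 'a = complex] algebra_simps)
  qed
  moreover have "continuous_on {0..} ?U"
    by (intro continuous_intros)
  ultimately show ?thesis
    by (simp add: FS_solution_def)
qed

text \<open>A datum has to be singled out, since the zero solution decays. Existence of a solution
  is part of the claim, so that the statement about all solutions is not vacuous.\<close>

theorem theorem4p3:
  fixes k1 k2 k3 k4 k5 \<gamma> \<xi> :: real and \<tau> :: "real \<times> real \<times> real" and \<epsilon>0 :: nat
  assumes "k1 > 0" "k2 > 0" "k3 > 0" "k4 > 0" "k5 > 0"
    and "\<gamma> \<noteq> 0"
    and "\<tau> = (1, 0, 0)"
    and "\<epsilon>0 \<in> {0, 1}"
    and "k3 - k2 = 0"
  shows "\<exists>U0. (\<exists>U. FS_solution k1 k2 k3 k4 k5 \<gamma> \<tau> \<epsilon>0 \<xi> U0 U) \<and>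
           (\<forall>U. FS_solution k1 k2 k3 k4 k5 \<gamma> \<tau> \<epsilon>0 \<xi> U0 U \<longrightarrow>
              \<not> ((\<lambda>t. norm (U t)) \<longlongrightarrow> 0) at_top)"
proof (intro exI conjI allI impI notI)
  define m where "m = sqrt k2"
  have m: "m > 0" "complex_of_real k2 = of_real m * of_real m"
    using assms by (simp_all add: m_def flip: of_real_mult)
  have k3: "k3 = k2" using assms by simp
  show "FS_solution k1 k2 k3 k4 k5 \<gamma> \<tau> \<epsilon>0 \<xi> (undamped_mode m)
    (\<lambda>t. cos (\<xi> * m * t) *\<^sub>R undamped_mode m + sin (\<xi> * m * t) *\<^sub>R (\<i> *s undamped_mode m))"
    using FS_solution_undamped_mode[of k2] assms k3 by (simp add: m_def)
  fix U
  assume sol: "FS_solution k1 k2 k3 k4 k5 \<gamma> \<tau> \<epsilon>0 \<xi> (undamped_mode m) U"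
    and lim: "((\<lambda>t. norm (U t)) \<longlongrightarrow> 0) at_top"
  \<comment> \<open>As a row vector, \<open>L\<close> is a left eigenvector for the same eigenvalue
    \<open>\<i> * \<xi> * m\<close>; this gives a scalar equation along an arbitrary solution
    \<open>U\<close>.\<close>
  define L :: "complex ^ 8 \<Rightarrow> complex"
    where "L = (\<lambda>V. of_real m * (V $ 3 - V $ 5) + (V $ 4 - V $ 6))"
  have L: "bounded_linear L"
    unfolding L_def
    by (intro bounded_linear_add bounded_linear_sub bounded_linear_const_mult bounded_linear_vec_nth)
  have cont: "continuous_on {0..} (\<lambda>t. L (U t))"
    using sol by (auto simp: FS_solution_def intro: bounded_linear.continuous_on[OF L])
  have deriv: "((\<lambda>t. L (U t)) has_vector_derivative \<i> * of_real (\<xi> * m) * L (U t)) (at t)"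
    if "t > 0" for t
  proof -
    obtain D where D: "(U has_vector_derivative D) (at t)"
      and "FS_equations k1 k2 k3 k4 k5 \<gamma> \<tau> \<epsilon>0 \<xi> (U t) D"
      using sol \<open>t > 0\<close> by (auto simp: FS_solution_def)
    then have D_nth:
      "D $ 3 = \<i> * of_real \<xi> * U t $ 4"
      "D $ 4 = \<i> * of_real k2 * of_real \<xi> * U t $ 3 - of_real k1 * U t $ 1"
      "D $ 5 = \<i> * of_real \<xi> * U t $ 6"
      "D $ 6 = \<i> * of_real k2 * of_real \<xi> * U t $ 5 - of_real k1 * U t $ 1"
      using assms by (simp_all add: FS_equations_def Let_def k3 algebra_simps)
    \<comment> \<open>The \<open>k1\<close> terms cancel in \<open>D $ 4 - D $ 6\<close>, and
      writing \<open>k2\<close> as \<open>m * m\<close> lets one factor \<open>m\<close> be pulled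
      out.\<close>
    have "L D = \<i> * of_real (\<xi> * m) * L (U t)"
      unfolding L_def D_nth m(2) by (simp add: algebra_simps)
    then show ?thesis
      using bounded_linear.has_vector_derivative[OF L D] by simp
  qed
  have "U 0 = undamped_mode m"
    using sol by (simp add: FS_solution_def)
  \<comment> \<open>The value is \<open>4 * m\<close>.\<close>
  then have "L (U 0) \<noteq> 0"
    using m(1) by (simp add: L_def flip: of_real_add)
  have "((\<lambda>t. L (U t)) \<longlongrightarrow> 0) at_top"
    by (rule bounded_linear.tendsto_zero[OF L tendsto_norm_zero_cancel[OF lim]])
  then have "((\<lambda>t. norm (L (U t))) \<longlongrightarrow> 0) at_top"
    by (rule tendsto_norm_zero)
  moreover have "\<forall>\<^sub>F t in at_top. norm (L (U t)) = norm (L (U 0))"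
    using eventually_ge_at_top[of 0]
    by eventually_elim (rule constant_modulus_of_rotation[OF cont deriv])
  ultimately have "((\<lambda>t::real. norm (L (U 0))) \<longlongrightarrow> 0) at_top"
    by (rule Lim_transform_eventually)
  then show False
    using \<open>L (U 0) \<noteq> 0\<close> by (simp add: tendsto_const_iff)
qed

end
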